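(* Let $a<b$ with $[a,b]\subseteq\mathcal I$ and let $\xi,\beta,\gamma,\delta\in\mathbb R$. Assume that the homogeneous boundary value problem $$Lx=0,\qquad \xi x(a)-\beta D^{\alpha}x(a)=0,\qquad \gamma x(b)+\delta D^{\alpha}x(b)=0 \qquad(\ast)$$ has only the trivial solution. Let $\phi$ be the solution of the initial value problem $$L\phi=0,\qquad \phi(a)=\beta,\qquad D^{\alpha}\phi(a)=\xi,$$ and let $\psi$ be the solution of $$L\psi=0,\qquad \psi(b)=\delta,\qquad D^{\alpha}\psi(b)=-\gamma.$$ Then Green's function for the boundary value problem $(\ast)$ is given by $$G(t,s)=\frac{1}{p(s)W(\phi,\psi)(s)}\begin{cases}\phi(t)\psi(s)&: a\le t\le s\le b,\\ \psi(t)\phi(s)&: a\le s\le t\le b.\end{cases}$$ Furthermore, $G$ satisfies $$e_0(s,t)G(t,s)=e_0(t,s)G(s,t)\qquad\text{for } s,t\in[a,b].$$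
   Context: $\mathcal I\subseteq\mathbb R$ is a nondegenerate interval. The functions $\kappa_0,\kappa_1:[0,1]\times\mathcal I\to[0,\infty)$ are continuous and satisfy, for all $t\in\mathcal I$: $\lim_{\alpha\to0^+}\kappa_1(\alpha,t)=1$, $\lim_{\alpha\to0^+}\kappa_0(\alpha,t)=0$, $\lim_{\alpha\to1^-}\kappa_1(\alpha,t)=0$, $\lim_{\alpha\to1^-}\kappa_0(\alpha,t)=1$, $\kappa_1(\alpha,t)\ne0$ for $\alpha\in[0,1)$, and $\kappa_0(\alpha,t)\neq0$ for $\alpha\in(0,1]$. Fix $\alpha\in(0,1]$ and write $\kappa_j(t)=\kappa_j(\alpha,t)$. The conformable (proportional) derivative is $D^{\alpha}f(t)=\kappa_1(t)f(t)+\kappa_0(t)f'(t)$; for functions of $(t,s)$ it acts on the first variable. For $t,s\in\mathcal I$, $e_0(t,s)=\exp\left(-\int_s^t\frac{\kappa_1(\tau)}{\kappa_0(\tau)}\,d\tau\right)$. Let $p,q$ be continuous on $\mathcal I$ with $p(t)>0$ for all $t\in\mathcal I$, and set $Lx=D^{\alpha}[pD^{\alpha}x]+qx$. A solution of $Lx=0$ is a continuous function $x$ such that $D^{\alpha}x$ and $D^{\alpha}[pD^{\alpha}x]$ exist and are continuous and $Lx=0$ holds at every point of the interval considered. The conformable Wronskian is $W(x,y)=xD^{\alpha}y-yD^{\alpha}x$. The Cauchy function $x(t,s)$ for $Lx=0$ is defined by: for each fixed $s$, $x(\cdot,s)$ is the solution of $Lx(\cdot,s)=0$, $x(s,s)=0$,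 $D^{\alpha}x(s,s)=1/p(s)$. Green's function for $(\ast)$ is, by definition, $G(t,s)=u(t,s)$ for $a\le t\le s\le b$ and $G(t,s)=u(t,s)+x(t,s)$ for $a\le s\le t\le b$, where for each fixed $s\in[a,b]$, $u(\cdot,s)$ is the unique solution of $Lu(\cdot,s)=0$, $\xi u(a,s)-\beta D^{\alpha}u(a,s)=0$, $\gamma u(b,s)+\delta D^{\alpha}u(b,s)=-\gamma x(b,s)-\delta D^{\alpha}x(b,s)$. *)

theory Defs
  imports "HOL-Analysis.Analysis"
begin

definition proportional_controls ::
  "real set \<Rightarrow> (real \<Rightarrow> real \<Rightarrow> real) \<Rightarrow> (real \<Rightarrow> real \<Rightarrow> real) \<Rightarrow> bool" where
  "proportional_controls I \<kappa>0 \<kappa>1 \<longleftrightarrow>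
     continuous_on ({0..1} \<times> I) (\<lambda>(\<alpha>, t). \<kappa>0 \<alpha> t) \<and>
     continuous_on ({0..1} \<times> I) (\<lambda>(\<alpha>, t). \<kappa>1 \<alpha> t) \<and>
     (\<forall>\<alpha>\<in>{0..1}. \<forall>t\<in>I. 0 \<le> \<kappa>0 \<alpha> t \<and> 0 \<le> \<kappa>1 \<alpha> t) \<and>
     (\<forall>t\<in>I.
        ((\<lambda>\<alpha>. \<kappa>1 \<alpha> t) \<longlongrightarrow> 1) (at_right 0) \<and>
        ((\<lambda>\<alpha>. \<kappa>0 \<alpha> t) \<longlongrightarrow> 0) (at_right 0) \<and>
        ((\<lambda>\<alpha>. \<kappa>1 \<alpha> t) \<longlongrightarrow> 0) (at_left 1) \<and>
        ((\<lambda>\<alpha>. \<kappa>0 \<alpha> t) \<longlongrightarrow> 1) (at_left 1) \<and>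
        (\<forall>\<alpha>\<in>{0..<1}. \<kappa>1 \<alpha> t \<noteq> 0) \<and>
        (\<forall>\<alpha>\<in>{0<..1}. \<kappa>0 \<alpha> t \<noteq> 0))"

text \<open>
  From here on \<open>k0\<close>, \<open>k1\<close> are the two controls at a fixed \<open>\<alpha>\<close>, and \<open>J\<close> is the interval on which
  the equation is considered. Derivatives are taken within \<open>J\<close>, hence one-sided at those end
  points that belong to \<open>J\<close>. The value of \<open>conf_deriv\<close> is meaningful only where the
  derivative exists; \<open>SL_solution\<close> demands this explicitly.
\<close>

definition conf_deriv ::
  "real set \<Rightarrow> (real \<Rightarrow> real) \<Rightarrow> (real \<Rightarrow> real) \<Rightarrow> (real \<Rightarrow> real) \<Rightarrow> real \<Rightarrow> real" where
  "conf_deriv J k0 k1 f t = k1 t * f t + k0 t * vector_derivative f (at t within J)"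

definition conf_exp0 :: "(real \<Rightarrow> real) \<Rightarrow> (real \<Rightarrow> real) \<Rightarrow> real \<Rightarrow> real \<Rightarrow> real" where
  "conf_exp0 k0 k1 t s = exp (- (LBINT \<tau>=s..t. k1 \<tau> / k0 \<tau>))"

definition conf_wronskian ::
  "real set \<Rightarrow> (real \<Rightarrow> real) \<Rightarrow> (real \<Rightarrow> real) \<Rightarrow> (real \<Rightarrow> real) \<Rightarrow> (real \<Rightarrow> real) \<Rightarrow> real \<Rightarrow> real" where
  "conf_wronskian J k0 k1 x y t = x t * conf_deriv J k0 k1 y t - y t * conf_deriv J k0 k1 x t"

definition SL_op ::
  "real set \<Rightarrow> (real \<Rightarrow> real) \<Rightarrow> (real \<Rightarrow> real) \<Rightarrow> (real \<Rightarrow> real) \<Rightarrow> (real \<Rightarrow> real) \<Rightarrow>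
   (real \<Rightarrow> real) \<Rightarrow> real \<Rightarrow> real" where
  "SL_op J k0 k1 p q x t =
     conf_deriv J k0 k1 (\<lambda>\<tau>. p \<tau> * conf_deriv J k0 k1 x \<tau>) t + q t * x t"

definition SL_solution ::
  "real set \<Rightarrow> (real \<Rightarrow> real) \<Rightarrow> (real \<Rightarrow> real) \<Rightarrow> (real \<Rightarrow> real) \<Rightarrow> (real \<Rightarrow> real) \<Rightarrow>
   (real \<Rightarrow> real) \<Rightarrow> bool" where
  "SL_solution J k0 k1 p q x \<longleftrightarrow>
     continuous_on J x \<and>
     (\<forall>t\<in>J. x differentiable (at t within J)) \<and>
     continuous_on J (conf_deriv J k0 k1 x) \<and>
     (\<forall>t\<in>J. (\<lambda>\<tau>. p \<tau> * conf_deriv J k0 k1 x \<tau>) differentiable (at t within J)) \<and>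
     continuous_on J (conf_deriv J k0 k1 (\<lambda>\<tau>. p \<tau> * conf_deriv J k0 k1 x \<tau>)) \<and>
     (\<forall>t\<in>J. SL_op J k0 k1 p q x t = 0)"

text \<open>Functions of two variables are curried: \<open>x t s\<close> stands for $x(t,s)$.\<close>

definition cauchy_function ::
  "real set \<Rightarrow> (real \<Rightarrow> real) \<Rightarrow> (real \<Rightarrow> real) \<Rightarrow> (real \<Rightarrow> real) \<Rightarrow> (real \<Rightarrow> real) \<Rightarrow>
   (real \<Rightarrow> real \<Rightarrow> real) \<Rightarrow> bool" where
  "cauchy_function J k0 k1 p q x \<longleftrightarrow>
     (\<forall>s\<in>J. SL_solution J k0 k1 p q (\<lambda>t. x t s) \<and> x s s = 0 \<and>
            conf_deriv J k0 k1 (\<lambda>t. x t s) s = 1 / p s)"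

text \<open>The right end condition is allowed to be inhomogeneous, with value \<open>\<eta>\<close>.\<close>

definition SL_bvp_solution ::
  "real set \<Rightarrow> (real \<Rightarrow> real) \<Rightarrow> (real \<Rightarrow> real) \<Rightarrow> (real \<Rightarrow> real) \<Rightarrow> (real \<Rightarrow> real) \<Rightarrow>
   real \<Rightarrow> real \<Rightarrow> real \<Rightarrow> real \<Rightarrow> real \<Rightarrow> real \<Rightarrow> real \<Rightarrow> (real \<Rightarrow> real) \<Rightarrow> bool" where
  "SL_bvp_solution J k0 k1 p q a b \<xi> \<beta> \<gamma> \<delta> \<eta> x \<longleftrightarrow>
     SL_solution J k0 k1 p q x \<and>
     \<xi> * x a - \<beta> * conf_deriv J k0 k1 x a = 0 \<and>
     \<gamma> * x b + \<delta> * conf_deriv J k0 k1 x b = \<eta>"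

text \<open>
  Only the values of \<open>G\<close> on \<open>{a..b} \<times> {a..b}\<close> are constrained. The existence of \<open>x\<close> and \<open>u\<close>, and
  the uniqueness of \<open>u\<close>, are part of the definition.
\<close>

definition greens_function ::
  "real set \<Rightarrow> (real \<Rightarrow> real) \<Rightarrow> (real \<Rightarrow> real) \<Rightarrow> (real \<Rightarrow> real) \<Rightarrow> (real \<Rightarrow> real) \<Rightarrow>
   real \<Rightarrow> real \<Rightarrow> real \<Rightarrow> real \<Rightarrow> real \<Rightarrow> real \<Rightarrow> (real \<Rightarrow> real \<Rightarrow> real) \<Rightarrow> bool" where
  "greens_function J k0 k1 p q a b \<xi> \<beta> \<gamma> \<delta> G \<longleftrightarrow>
     (\<exists>x u. cauchy_function J k0 k1 p q x \<and>
        (\<forall>s\<in>{a..b}.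
           let \<eta> = - \<gamma> * x b s - \<delta> * conf_deriv J k0 k1 (\<lambda>t. x t s) b in
             SL_bvp_solution J k0 k1 p q a b \<xi> \<beta> \<gamma> \<delta> \<eta> (\<lambda>t. u t s) \<and>
             (\<forall>v. SL_bvp_solution J k0 k1 p q a b \<xi> \<beta> \<gamma> \<delta> \<eta> v \<longrightarrow> (\<forall>t\<in>J. v t = u t s))) \<and>
        (\<forall>t\<in>{a..b}. \<forall>s\<in>{a..b}.
           (t \<le> s \<longrightarrow> G t s = u t s) \<and> (s \<le> t \<longrightarrow> G t s = u t s + x t s)))"

end

theory Submission
  imports Defs
begin

text \<open>
  With \<open>y = p D x\<close> the equation \<open>L x = 0\<close> is a linear first-order system for \<open>(x, y)\<close>, whose
  determinant \<open>p W(x, u)\<close> satisfies Abel's formula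
  \<open>(p W)(t) = (p W)(s) e\<^sub>0(t, s)\<^sup>2\<close>. If \<open>W(\<phi>, \<psi>)\<close> vanished somewhere, \<open>\<phi>\<close> and \<open>\<psi>\<close> would
  solve the homogeneous boundary value problem, hence be zero, so \<open>\<xi> = \<beta> = \<gamma> = \<delta> = 0\<close>; then every
  solution of \<open>L x = 0\<close> solves that problem, and a nonzero one exists by Picard iteration. So
  \<open>\<phi>, \<psi>\<close> is a basis, \<open>x(t,s) = (\<phi>(s) \<psi>(t) - \<psi>(s) \<phi>(t)) / (p W)(s)\<close> is the Cauchy function and
  \<open>u(t,s) = \<psi>(s) \<phi>(t) / (p W)(s)\<close>. The symmetry of \<open>G\<close> is Abel's formula.
\<close>

section \<open>Differentiation and integration within an arbitrary real interval\<close>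

text \<open>\<open>J\<close> may be open, half-open or unbounded, while the fundamental theorem of
  calculus and the Picard bounds are applied on compact intervals. The ends \<open>c\<close> and
  \<open>d\<close> are chosen strictly beyond \<open>a\<close> and \<open>t\<close> wherever
  \<open>J\<close> extends further, so \<open>{c..d}\<close> and \<open>J\<close> coincide near
  \<open>t\<close>.\<close>

lemma interval_compact_neighbourhood:
  fixes J :: "real set"
  assumes "is_interval J" "a \<in> J" "t \<in> J"
  obtains c d where "c \<le> a" "a \<le> d" "c \<le> t" "t \<le> d" "{c..d} \<subseteq> J"
    "at t within J = at t within {c..d}"
proof -
  have "\<exists>c. c \<in> J \<and> c \<le> min a t \<and> (c < min a t \<or> (c = min a t \<and> (\<forall>x\<in>J. min a t \<le> x)))"
    using assms by (cases "\<exists>x\<in>J. x < min a t") (auto simp: min_def not_less intro: less_imp_le)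
  then obtain c where c: "c \<in> J" "c \<le> min a t" "c < min a t \<or> (c = min a t \<and> (\<forall>x\<in>J. min a t \<le> x))"
    by blast
  have "\<exists>d. d \<in> J \<and> max a t \<le> d \<and> (max a t < d \<or> (d = max a t \<and> (\<forall>x\<in>J. x \<le> max a t)))"
    using assms by (cases "\<exists>x\<in>J. max a t < x") (auto simp: max_def not_less intro: less_imp_le)
  then obtain d where d: "d \<in> J" "max a t \<le> d" "max a t < d \<or> (d = max a t \<and> (\<forall>x\<in>J. x \<le> max a t))"
    by blast
  have sub: "{c..d} \<subseteq> J"
    using c(1) d(1) \<open>is_interval J\<close> by (meson atLeastAtMost_iff mem_is_interval_1_I subsetI)
  \<comment> \<open>On a side where \<open>{c..d}\<close> stops at \<open>t\<close> itself, so does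
    \<open>J\<close>, and nothing has to be cut off there.\<close>
  define S where "S = (if c < t then {c<..} else UNIV) \<inter> (if t < d then {..<d} else UNIV)"
  have "at t within J = at t within {c..d}"
  proof (rule at_within_nhd)
    show "t \<in> S" "open S" by (auto simp: S_def)
    have "x \<in> {c..d}" if "x \<in> J" "x \<in> S" for x
      using that c(2,3) d(2,3) by (force simp: S_def split: if_splits)
    with sub show "J \<inter> S - {t} = {c..d} \<inter> S - {t}" by blast
  qed
  with that[of c d] sub c(2) d(2) show thesis by simp
qed

lemma interval_integral_has_vector_derivative:
  fixes f :: "real \<Rightarrow> 'a::euclidean_space" and J :: "real set"
  assumes "is_interval J" "continuous_on J f" "a \<in> J" "t \<in> J"
  shows "((\<lambda>u. LBINT s=a..u. f s) has_vector_derivative f t) (at t within J)"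
proof -
  obtain c d where "c \<le> a" "a \<le> d" "c \<le> t" "t \<le> d" "{c..d} \<subseteq> J"
    and eq: "at t within J = at t within {c..d}"
    by (rule interval_compact_neighbourhood[OF assms(1,3,4)])
  then show ?thesis
    unfolding eq by (intro interval_integral_FTC2 continuous_on_subset[OF assms(2)])
qed

text \<open>Integrating the bound for \<open>f'\<close> from \<open>a\<close> to \<open>t\<close>
  raises the power and the factorial by one; this is the induction step of the Picard estimate. The
  mean value inequality is applied on the segment from \<open>a\<close> to \<open>t\<close>,
  parametrised over \<open>{0..1}\<close>, which treats \<open>t < a\<close> and
  \<open>a < t\<close> alike.\<close>

lemma norm_le_power_of_derivative_le:
  fixes f :: "real \<Rightarrow> 'a::real_normed_vector"
  assumes der: "\<And>t. t \<in> {c..d} \<Longrightarrow> (f has_vector_derivative f' t) (at t within {c..d})"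
    and a: "a \<in> {c..d}" "f a = 0" and t: "t \<in> {c..d}"
    and bnd: "\<And>t. t \<in> {c..d} \<Longrightarrow> norm (f' t) \<le> M * (C * (M * \<bar>t - a\<bar>) ^ n / fact n)"
  shows "norm (f t) \<le> C * (M * \<bar>t - a\<bar>) ^ Suc n / fact (Suc n)"
proof -
  define g where "g r = a + r * (t - a)" for r
  have g: "g r \<in> {c..d}" if "r \<in> {0..1}" for r
  proof -
    have "g r = (1 - r) *\<^sub>R a + r *\<^sub>R t" by (simp add: g_def algebra_simps)
    also have "\<dots> \<in> {c..d}"
      using convexD_alt[OF convex_real_interval(5)[of c d] a(1) t, of r] that by simp
    finally show ?thesis .
  qed
  have dh: "((f \<circ> g) has_vector_derivative (t - a) *\<^sub>R f' (g r)) (at r within {0..1})"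
    if "r \<in> {0..1}" for r
  proof (rule vector_diff_chain_within)
    show "(g has_vector_derivative t - a) (at r within {0..1})"
      unfolding g_def by (auto intro!: derivative_eq_intros)
    show "(f has_vector_derivative f' (g r)) (at (g r) within g ` {0..1})"
      by (rule has_vector_derivative_within_subset[OF der[OF g[OF that]]]) (use g in auto)
  qed
  define K where "K = C * (M * \<bar>t - a\<bar>) ^ Suc n / fact (Suc n)"
  \<comment> \<open>The claimed bound at the point \<open>g r\<close>, whose distance from
    \<open>a\<close> is \<open>\<bar>t - a\<bar> * r\<close>. It grows from \<open>0\<close> to
    \<open>K\<close>, and its derivative is the assumed bound at \<open>g r\<close> times
    \<open>\<bar>t - a\<bar>\<close>.\<close>
  define \<phi> where "\<phi> r = K * r ^ Suc n" for r :: real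
  define \<phi>' where "\<phi>' r = K * (Suc n * r ^ n)" for r :: real
  have d\<phi>: "(\<phi> has_real_derivative \<phi>' r) (at r)" for r
    unfolding \<phi>_def \<phi>'_def using DERIV_cmult[OF DERIV_pow[of "Suc n" r UNIV], of K] by simp
  have "K * Suc n = \<bar>t - a\<bar> * M * C * (M * \<bar>t - a\<bar>) ^ n / fact n"
    unfolding K_def fact_Suc by (simp del: of_nat_Suc)
  then have \<phi>'_eq: "\<phi>' r = \<bar>t - a\<bar> * (M * (C * (M * (\<bar>t - a\<bar> * r)) ^ n / fact n))" for r
    unfolding \<phi>'_def mult.assoc[symmetric] by (simp add: power_mult_distrib)
  have "norm ((f \<circ> g) 1 - (f \<circ> g) 0) \<le> \<phi> 1 - \<phi> 0"
  proof (rule differentiable_bound_general)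
    show "continuous_on {0..1} (f \<circ> g)"
      by (rule continuous_on_vector_derivative) (rule dh)
    show "continuous_on {0..1} \<phi>"
      unfolding \<phi>_def by (intro continuous_intros)
    fix r :: real assume r: "0 < r" "r < 1"
    then show "((f \<circ> g) has_vector_derivative (t - a) *\<^sub>R f' (g r)) (at r)"
      using dh[of r] by (simp add: at_within_Icc_at)
    show "(\<phi> has_vector_derivative \<phi>' r) (at r)"
      using d\<phi> by (simp add: has_real_derivative_iff_has_vector_derivative)
    have "\<bar>g r - a\<bar> = \<bar>t - a\<bar> * r" using r by (simp add: g_def abs_mult)
    then show "norm ((t - a) *\<^sub>R f' (g r)) \<le> \<phi>' r"
      using mult_left_mono[OF bnd[OF g[of r]], of "\<bar>t - a\<bar>"] r
      unfolding \<phi>'_eq by simp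
  qed simp
  then show ?thesis by (simp add: \<phi>_def K_def g_def a(2))
qed

text \<open>The derivative at \<open>x\<close> is the linear map that sends \<open>h\<close> to
  \<open>h *\<^sub>R g' x\<close>, so a uniform error \<open>e\<close> between vectors becomes the
  error \<open>e * norm h\<close> between maps that \<open>has_derivative_series\<close> asks
  for.\<close>

lemma has_vector_derivative_series:
  fixes f :: "nat \<Rightarrow> real \<Rightarrow> 'a::banach"
  assumes "convex S"
    and der: "\<And>n x. x \<in> S \<Longrightarrow> (f n has_vector_derivative f' n x) (at x within S)"
    and lim: "uniform_limit S (\<lambda>n x. \<Sum>i<n. f' i x) g' sequentially"
    and "x0 \<in> S" "summable (\<lambda>n. f n x0)"
  shows "\<exists>g. \<forall>x\<in>S. (\<lambda>n. f n x) sums g x \<and> (g has_vector_derivative g' x) (at x within S)"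
  unfolding has_vector_derivative_def
proof (rule has_derivative_series)
  show "(\<lambda>n. f n x0) sums suminf (\<lambda>n. f n x0)" using assms by auto
  fix e :: real assume "e > 0"
  then have "\<forall>\<^sub>F n in sequentially. \<forall>x\<in>S. dist (\<Sum>i<n. f' i x) (g' x) < e"
    using lim by (rule uniform_limitD[rotated])
  then show "\<forall>\<^sub>F n in sequentially. \<forall>x\<in>S. \<forall>h. norm ((\<Sum>i<n. h *\<^sub>R f' i x) - h *\<^sub>R g' x) \<le> e * norm h"
  proof eventually_elim
    case (elim n)
    show ?case
    proof (intro ballI allI)
      fix x h assume "x \<in> S"
      with elim have "norm ((\<Sum>i<n. f' i x) - g' x) \<le> e" by (simp add: dist_norm less_imp_le)
      then have "\<bar>h\<bar> * norm ((\<Sum>i<n. f' i x) - g' x) \<le> \<bar>h\<bar> * e" by (rule mult_left_mono) simp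
      also have "\<bar>h\<bar> * norm ((\<Sum>i<n. f' i x) - g' x) = norm (h *\<^sub>R ((\<Sum>i<n. f' i x) - g' x))"
        by simp
      finally show "norm ((\<Sum>i<n. h *\<^sub>R f' i x) - h *\<^sub>R g' x) \<le> e * norm h"
        by (simp add: scaleR_right_diff_distrib scaleR_right.sum mult.commute)
    qed
  qed
qed (use assms in \<open>auto simp: has_vector_derivative_def\<close>)

section \<open>Picard iteration for linear systems\<close>

text \<open>These are the increments of the Picard iterates: by linearity the iterates are the
  partial sums, and the solution is a series.\<close>

primrec picard_term ::
  "(real \<Rightarrow> 'a::euclidean_space \<Rightarrow>\<^sub>L 'a) \<Rightarrow> real \<Rightarrow> 'a \<Rightarrow> nat \<Rightarrow> real \<Rightarrow> 'a" where
  "picard_term F a x0 0 = (\<lambda>t. x0)"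
| "picard_term F a x0 (Suc n) = (\<lambda>t. LBINT s=a..t. F s (picard_term F a x0 n s))"

text \<open>On a compact interval around \<open>a\<close> and \<open>t\<close> with
  \<open>norm (F s) \<le> M\<close>, the terms are dominated by an exponential series, so the series
  may be differentiated term by term. Since this works around every \<open>t\<close>, the solution
  lives on all of \<open>J\<close>.\<close>

lemma linear_ode_exists:
  fixes F :: "real \<Rightarrow> 'a::euclidean_space \<Rightarrow>\<^sub>L 'a"
  assumes J: "is_interval J" "a \<in> J" and F: "continuous_on J F"
  obtains X where "X a = x0"
    "\<And>t. t \<in> J \<Longrightarrow> (X has_vector_derivative F t (X t)) (at t within J)"
proof -
  let ?f = "picard_term F a x0"
  have der_cont: "continuous_on J (?f n) \<and>
      (\<forall>t\<in>J. (?f (Suc n) has_vector_derivative F t (?f n t)) (at t within J))" for n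
  proof (induction n)
    case 0
    have "continuous_on J (\<lambda>t. F t x0)"
      by (intro continuous_intros F)
    from interval_integral_has_vector_derivative[OF J(1) this J(2)]
    show ?case by simp
  next
    case (Suc n)
    then have "continuous_on J (?f (Suc n))"
      by (intro continuous_on_vector_derivative[where f'="\<lambda>t. F t (?f n t)"]) simp
    moreover from this
    have "((\<lambda>t. LBINT s=a..t. F s (?f (Suc n) s)) has_vector_derivative F t (?f (Suc n) t))
        (at t within J)" if "t \<in> J" for t
      using F that by (intro interval_integral_has_vector_derivative J continuous_intros)
    ultimately show ?case by simp
  qed
  note picard_term.simps(2)[simp del]
  define X where "X t = (\<Sum>n. ?f n t)" for t
  have at_a: "?f (Suc n) a = 0" for n by (simp add: picard_term.simps(2))
  have X_a: "X a = x0"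
  proof -
    have "?f n a = (if n = 0 then x0 else 0)" for n by (cases n) (auto simp: at_a)
    then have "X a = (\<Sum>n. if n = 0 then x0 else 0)" by (simp add: X_def)
    also have "\<dots> = x0" by (rule sums_unique[symmetric]) (rule sums_single)
    finally show ?thesis .
  qed
  have "(X has_vector_derivative F t (X t)) (at t within J)" if t: "t \<in> J" for t
  proof -
    obtain c d where cd: "c \<le> a" "a \<le> d" "c \<le> t" "t \<le> d" and sub: "{c..d} \<subseteq> J"
      and eq: "at t within J = at t within {c..d}"
      by (rule interval_compact_neighbourhood[OF J t])
    have "bounded (F ` {c..d})"
      using compact_continuous_image[OF continuous_on_subset[OF F sub]] compact_imp_bounded by blast
    then obtain M where M: "M > 0" "\<And>s. s \<in> {c..d} \<Longrightarrow> norm (F s) \<le> M"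
      unfolding bounded_pos by auto
    have der: "(?f (Suc n) has_vector_derivative F s (?f n s)) (at s within {c..d})"
      if "s \<in> {c..d}" for n s
    proof -
      have "s \<in> J" using sub that by blast
      with der_cont[of n] have "(?f (Suc n) has_vector_derivative F s (?f n s)) (at s within J)"
        by (simp only: Ball_def)
      then show ?thesis by (rule has_vector_derivative_within_subset) (rule sub)
    qed
    have apply_le: "norm (F s v) \<le> M * norm v" if "s \<in> {c..d}" for s v
      using norm_blinfun[of "F s" v] mult_right_mono[OF M(2)[OF that], of "norm v"] by simp
    have bnd: "\<forall>s\<in>{c..d}. norm (?f n s) \<le> norm x0 * (M * \<bar>s - a\<bar>) ^ n / fact n" for n
    proof (induction n)
      case (Suc n)
      show ?case
      proof
        fix s assume s: "s \<in> {c..d}"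
        show "norm (?f (Suc n) s) \<le> norm x0 * (M * \<bar>s - a\<bar>) ^ Suc n / fact (Suc n)"
        proof (rule norm_le_power_of_derivative_le[OF der _ at_a s])
          fix r assume r: "r \<in> {c..d}"
          show "norm (F r (?f n r)) \<le> M * (norm x0 * (M * \<bar>r - a\<bar>) ^ n / fact n)"
            using order_trans[OF apply_le[OF r] mult_left_mono[OF Suc.IH[rule_format, OF r], of M]] M(1)
            by simp
        qed (use cd in auto)
      qed
    qed simp
    \<comment> \<open>A majorant independent of \<open>s\<close>, from
      \<open>\<bar>s - a\<bar> \<le> d - c\<close>.\<close>
    define K where "K n = norm x0 * (M * (d - c)) ^ n / fact n" for n
    have K: "norm (?f n s) \<le> K n" if s: "s \<in> {c..d}" for n s
    proof -
      have "(M * \<bar>s - a\<bar>) ^ n \<le> (M * (d - c)) ^ n"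
        using M(1) cd s by (intro power_mono mult_left_mono) auto
      then have "norm x0 * (M * \<bar>s - a\<bar>) ^ n / fact n \<le> K n"
        unfolding K_def by (intro divide_right_mono mult_left_mono) auto
      with bnd[of n] s show ?thesis by fastforce
    qed
    have sumK: "summable K"
      using summable_mult[OF summable_exp[of "M * (d - c)"], of "norm x0"]
      by (simp add: K_def[abs_def] field_simps)
    have sumf: "summable (\<lambda>n. ?f n s)" if "s \<in> {c..d}" for s
      by (rule summable_comparison_test'[OF sumK, of 0]) (rule K[OF that])
    have unif: "uniform_limit {c..d} (\<lambda>n s. \<Sum>i<n. F s (?f i s)) (\<lambda>s. \<Sum>i. F s (?f i s)) sequentially"
    proof (rule Weierstrass_m_test)
      show "norm (F s (?f n s)) \<le> M * K n" if "s \<in> {c..d}" for n s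
        using order_trans[OF apply_le[OF that] mult_left_mono[OF K[OF that], of M]] M(1) by simp
    qed (use sumK in \<open>rule summable_mult\<close>)
    \<comment> \<open>The series is differentiated from index 1 on, where the derivative of
      \<open>?f (Suc n)\<close> is \<open>F\<close> applied to \<open>?f n\<close>; the constant
      term \<open>x0\<close> of index 0 is added back afterwards.\<close>
    have "a \<in> {c..d}" "summable (\<lambda>n. ?f (Suc n) a)"
      using cd by (simp_all add: at_a)
    from has_vector_derivative_series[OF convex_real_interval(5) der unif this]
    obtain g where g: "\<And>s. s \<in> {c..d} \<Longrightarrow> (\<lambda>n. ?f (Suc n) s) sums g s"
        "\<And>s. s \<in> {c..d} \<Longrightarrow> (g has_vector_derivative (\<Sum>i. F s (?f i s))) (at s within {c..d})"
      by blast
    have X: "X s = g s + x0" if "s \<in> {c..d}" for s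
      using sums_unique[OF sums_Suc[OF g(1)[OF that]]] by (simp add: X_def)
    have t': "t \<in> {c..d}" using cd by simp
    have "((\<lambda>s. g s + x0) has_vector_derivative (\<Sum>i. F t (?f i t))) (at t within {c..d})"
      using has_vector_derivative_add[OF g(2)[OF t'] has_vector_derivative_const] by simp
    moreover have "(\<Sum>i. F t (?f i t)) = F t (X t)"
      unfolding X_def
      by (rule bounded_linear.suminf[OF blinfun.bounded_linear_right sumf[OF t'], symmetric])
    ultimately have "((\<lambda>s. g s + x0) has_vector_derivative F t (X t)) (at t within {c..d})" by simp
    then show "(X has_vector_derivative F t (X t)) (at t within J)"
      unfolding eq by (rule has_vector_derivative_transform[OF t' X, rotated])
  qed
  with X_a show thesis by (rule that)
qed

section \<open>The first-order system behind \<open>L x = 0\<close>\<close>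

locale conformable_SL =
  fixes J :: "real set" and k0 k1 p q :: "real \<Rightarrow> real"
  assumes interval: "is_interval J" and nontrivial: "\<exists>a\<in>J. \<exists>b\<in>J. a < b"
    and k0_cont: "continuous_on J k0" and k1_cont: "continuous_on J k1"
    and p_cont: "continuous_on J p" and q_cont: "continuous_on J q"
    and k0_pos: "\<And>t. t \<in> J \<Longrightarrow> 0 < k0 t" and p_pos: "\<And>t. t \<in> J \<Longrightarrow> 0 < p t"
begin

text \<open>The second component is \<open>y = p D x\<close>.\<close>

definition solves :: "(real \<Rightarrow> real) \<Rightarrow> (real \<Rightarrow> real) \<Rightarrow> bool" where
  "solves x y \<longleftrightarrow> (\<forall>t\<in>J.
     (x has_real_derivative (y t / p t - k1 t * x t) / k0 t) (at t within J) \<and>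
     (y has_real_derivative (- q t * x t - k1 t * y t) / k0 t) (at t within J))"

text \<open>A connected set with two points has no isolated point. Hence derivatives within
  \<open>J\<close> are unique, and \<open>conf_deriv\<close> can be computed from any derivative
  that has been found.\<close>

lemma at_within_ne_bot: "t \<in> J \<Longrightarrow> at t within J \<noteq> bot"
  using connected_imp_perfect[of J t] interval nontrivial
  by (force simp: trivial_limit_within is_interval_connected_1)

lemma conf_deriv_eq:
  assumes "(f has_real_derivative f') (at t within J)" "t \<in> J"
  shows "conf_deriv J k0 k1 f t = k1 t * f t + k0 t * f'"
  using vector_derivative_within[OF at_within_ne_bot[OF assms(2)], of f f'] assms(1)
  by (simp add: conf_deriv_def has_real_derivative_iff_has_vector_derivative)

lemma has_real_derivative_conf_deriv:
  assumes "f differentiable (at t within J)" "t \<in> J"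
  shows "(f has_real_derivative (conf_deriv J k0 k1 f t - k1 t * f t) / k0 t) (at t within J)"
  using assms vector_derivative_works[of f "at t within J"] k0_pos[OF assms(2)]
  by (simp add: conf_deriv_def has_real_derivative_iff_has_vector_derivative)

text \<open>Since \<open>k0\<close> is positive, \<open>D f = k1 f + k0 f'\<close> can be solved for
  \<open>f'\<close>; this is applied to \<open>x\<close> and to \<open>p D x\<close>, whose
  conformable derivative is \<open>- q x\<close>.\<close>

lemma SL_solution_solves:
  assumes "SL_solution J k0 k1 p q x"
  shows "solves x (\<lambda>t. p t * conf_deriv J k0 k1 x t)"
  unfolding solves_def
proof (intro ballI conjI)
  fix t assume t: "t \<in> J"
  let ?y = "\<lambda>t. p t * conf_deriv J k0 k1 x t"
  have "conf_deriv J k0 k1 ?y t = - q t * x t"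
    using assms t by (auto simp: SL_solution_def SL_op_def)
  then show "(?y has_real_derivative (- q t * x t - k1 t * ?y t) / k0 t) (at t within J)"
    using has_real_derivative_conf_deriv[of ?y t] assms t by (simp add: SL_solution_def)
  show "(x has_real_derivative (?y t / p t - k1 t * x t) / k0 t) (at t within J)"
    using has_real_derivative_conf_deriv[of x t] assms t p_pos[OF t] by (simp add: SL_solution_def)
qed

lemma solves_conf_deriv:
  assumes "solves x y" "t \<in> J"
  shows "conf_deriv J k0 k1 x t = y t / p t"
  using assms conf_deriv_eq[of x _ t] k0_pos[of t] by (auto simp: solves_def)

lemma solves_SL_solution:
  assumes "solves x y"
  shows "SL_solution J k0 k1 p q x"
proof -
  let ?y = "\<lambda>t. p t * conf_deriv J k0 k1 x t"
  have y: "?y t = y t" if "t \<in> J" for t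
    using solves_conf_deriv[OF assms that] p_pos[OF that] by simp
  have dx: "(x has_real_derivative (y t / p t - k1 t * x t) / k0 t) (at t within J)"
    and dy: "(y has_real_derivative (- q t * x t - k1 t * y t) / k0 t) (at t within J)"
    if "t \<in> J" for t using assms that by (auto simp: solves_def)
  \<comment> \<open>\<open>?y\<close> and \<open>y\<close> agree only on \<open>J\<close>, which
    suffices for derivatives within \<open>J\<close>.\<close>
  have dy': "(?y has_real_derivative (- q t * x t - k1 t * y t) / k0 t) (at t within J)"
    if "t \<in> J" for t
    using has_field_derivative_transform_within[OF dy[OF that] zero_less_one that] y by simp
  have Dy: "conf_deriv J k0 k1 ?y t = - q t * x t" if "t \<in> J" for t
    using conf_deriv_eq[OF dy'[OF that] that] y[OF that] k0_pos[OF that] by simp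
  have xc: "continuous_on J x"
    by (rule DERIV_continuous_on) (rule dx)
  have yc: "continuous_on J y"
    by (rule DERIV_continuous_on) (rule dy)
  have "continuous_on J (\<lambda>t. y t / p t)"
    using p_pos by (intro continuous_intros yc p_cont) force
  then have Dxc: "continuous_on J (conf_deriv J k0 k1 x)"
    by (rule continuous_on_cong[THEN iffD2, OF refl, rotated]) (rule solves_conf_deriv[OF assms])
  have "continuous_on J (\<lambda>t. - q t * x t)"
    by (intro continuous_intros xc q_cont)
  then have Dyc: "continuous_on J (conf_deriv J k0 k1 ?y)"
    by (rule continuous_on_cong[THEN iffD2, OF refl, rotated]) (rule Dy)
  show ?thesis
    unfolding SL_solution_def SL_op_def
  proof (intro conjI ballI xc Dxc Dyc)
    fix t assume t: "t \<in> J"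
    show "x differentiable (at t within J)"
      using dx[OF t] unfolding real_differentiable_def by (rule exI)
    show "?y differentiable (at t within J)"
      using dy'[OF t] unfolding real_differentiable_def by (rule exI)
    show "conf_deriv J k0 k1 ?y t + q t * x t = 0"
      by (simp add: Dy[OF t])
  qed
qed

lemma solves_lincomb:
  assumes "solves x y" "solves u v"
  shows "solves (\<lambda>t. c * x t + d * u t) (\<lambda>t. c * y t + d * v t)"
  unfolding solves_def
proof (intro ballI conjI)
  fix t assume t: "t \<in> J"
  note D = assms[unfolded solves_def, THEN bspec, OF t]
  show "((\<lambda>t. c * x t + d * u t) has_real_derivative
      ((c * y t + d * v t) / p t - k1 t * (c * x t + d * u t)) / k0 t) (at t within J)"
    using DERIV_add[OF DERIV_cmult[OF D(1)[THEN conjunct1], of c] DERIV_cmult[OF D(2)[THEN conjunct1], of d]]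
    by (simp add: add_divide_distrib diff_divide_distrib algebra_simps)
  show "((\<lambda>t. c * y t + d * v t) has_real_derivative
      (- q t * (c * x t + d * u t) - k1 t * (c * y t + d * v t)) / k0 t) (at t within J)"
    using DERIV_add[OF DERIV_cmult[OF D(1)[THEN conjunct2], of c] DERIV_cmult[OF D(2)[THEN conjunct2], of d]]
    by (simp add: add_divide_distrib diff_divide_distrib algebra_simps)
qed

section \<open>The conformable exponential and Abel's formula\<close>

lemma conf_exp0_reverse: "conf_exp0 k0 k1 s t * conf_exp0 k0 k1 t s = 1"
  using interval_integral_endpoints_reverse[of s t "\<lambda>\<tau>. k1 \<tau> / k0 \<tau>"]
  by (simp add: conf_exp0_def exp_add[symmetric])

lemma conf_exp0_has_derivative:
  assumes "s \<in> J" "t \<in> J"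
  shows "((\<lambda>t. conf_exp0 k0 k1 t s) has_real_derivative
    - (k1 t / k0 t) * conf_exp0 k0 k1 t s) (at t within J)"
proof -
  have "continuous_on J (\<lambda>t. k1 t / k0 t)"
    using k0_pos by (intro continuous_intros k0_cont k1_cont) force
  from interval_integral_has_vector_derivative[OF interval this assms]
  show ?thesis
    unfolding conf_exp0_def has_real_derivative_iff_has_vector_derivative[symmetric]
    by (auto intro!: derivative_eq_intros)
qed

text \<open>The coefficient matrix of the system has trace \<open>- 2 * (k1 t / k0 t)\<close>, which
  is also the logarithmic derivative of the squared exponential. The quotient of determinant and
  square is therefore constant on \<open>J\<close>, and the exponential is \<open>1\<close> at
  \<open>t = s\<close>.\<close>

lemma wronskian_Abel:
  assumes "solves x y" "solves u v" "s \<in> J" "t \<in> J"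
  shows "x t * v t - u t * y t = (x s * v s - u s * y s) * conf_exp0 k0 k1 t s ^ 2"
proof -
  let ?e = "\<lambda>t. conf_exp0 k0 k1 t s"
  let ?V = "\<lambda>t. x t * v t - u t * y t"
  have epos: "?e t \<noteq> 0" for t by (simp add: conf_exp0_def)
  have "((\<lambda>t. ?V t / ?e t ^ 2) has_real_derivative 0) (at t within J)" if t: "t \<in> J" for t
  proof -
    have d: "(x has_real_derivative (y t / p t - k1 t * x t) / k0 t) (at t within J)"
      "(y has_real_derivative (- q t * x t - k1 t * y t) / k0 t) (at t within J)"
      "(u has_real_derivative (v t / p t - k1 t * u t) / k0 t) (at t within J)"
      "(v has_real_derivative (- q t * u t - k1 t * v t) / k0 t) (at t within J)"
      using assms(1,2) t by (auto simp: solves_def)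
    have dV: "(?V has_real_derivative - 2 * (k1 t / k0 t) * ?V t) (at t within J)"
      using DERIV_diff[OF DERIV_mult[OF d(1,4)] DERIV_mult[OF d(3,2)]] k0_pos[OF t] p_pos[OF t]
      by (elim DERIV_cong) (simp add: field_simps)
    have de: "((\<lambda>t. ?e t ^ 2) has_real_derivative - 2 * (k1 t / k0 t) * ?e t ^ 2) (at t within J)"
      using DERIV_power[OF conf_exp0_has_derivative[OF assms(3) t], of 2]
      by (rule DERIV_cong) (simp add: power2_eq_square)
    show ?thesis
    proof (rule DERIV_cong[OF DERIV_divide[OF dV de]])
      show "(- 2 * (k1 t / k0 t) * ?V t * ?e t ^ 2 - ?V t * (- 2 * (k1 t / k0 t) * ?e t ^ 2)) /
          (?e t ^ 2 * ?e t ^ 2) = 0"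
        by simp
    qed (use epos in simp)
  qed
  from has_field_derivative_zero_constant[OF is_interval_convex[OF interval] this]
  obtain c where c: "\<And>t. t \<in> J \<Longrightarrow> ?V t / ?e t ^ 2 = c"
    by blast
  have "?V t / ?e t ^ 2 = ?V s / ?e s ^ 2" using c assms(3,4) by simp
  moreover have "?e s = 1" by (simp add: conf_exp0_def)
  ultimately show ?thesis using epos[of t] by (simp add: field_simps)
qed

section \<open>Existence of a nonzero solution\<close>

lemma nontrivial_solution_exists:
  assumes "a \<in> J"
  obtains x y where "solves x y" "x a = 1"
proof -
  \<comment> \<open>\<open>M\<close> and \<open>N\<close> are the off-diagonal matrix units. They
    turn the coefficient matrix \<open>F\<close> into a combination of fixed operators with
    continuous scalar coefficients.\<close>
  define M :: "(real \<times> real) \<Rightarrow>\<^sub>L (real \<times> real)" where "M = Blinfun (\<lambda>z. (snd z, 0))"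
  define N :: "(real \<times> real) \<Rightarrow>\<^sub>L (real \<times> real)" where "N = Blinfun (\<lambda>z. (0, fst z))"
  have M: "blinfun_apply M z = (snd z, 0)" for z
    unfolding M_def by (subst bounded_linear_Blinfun_apply)
      (auto intro!: bounded_linear_intros)
  have N: "blinfun_apply N z = (0, fst z)" for z
    unfolding N_def by (subst bounded_linear_Blinfun_apply)
      (auto intro!: bounded_linear_intros)
  define F where "F t = (1 / (p t * k0 t)) *\<^sub>R M - (q t / k0 t) *\<^sub>R N - (k1 t / k0 t) *\<^sub>R id_blinfun" for t
  have "continuous_on J F"
    unfolding F_def using k0_pos p_pos
    by (intro continuous_intros k0_cont k1_cont p_cont q_cont) force+
  from linear_ode_exists[OF interval assms this, of "(1, 0)"]
  obtain X where X: "X a = (1, 0)"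
    "\<And>t. t \<in> J \<Longrightarrow> (X has_vector_derivative F t (X t)) (at t within J)" by blast
  have "solves (\<lambda>t. fst (X t)) (\<lambda>t. snd (X t))"
    unfolding solves_def
  proof (intro ballI conjI)
    fix t assume t: "t \<in> J"
    note bounded_linear.has_vector_derivative[OF bounded_linear_fst X(2)[OF t]]
      bounded_linear.has_vector_derivative[OF bounded_linear_snd X(2)[OF t]]
    moreover have "fst (F t (X t)) = (snd (X t) / p t - k1 t * fst (X t)) / k0 t"
      "snd (F t (X t)) = (- q t * fst (X t) - k1 t * snd (X t)) / k0 t"
      by (simp_all add: F_def M N blinfun.bilinear_simps diff_divide_distrib)
    ultimately show
      "((\<lambda>t. fst (X t)) has_real_derivative (snd (X t) / p t - k1 t * fst (X t)) / k0 t) (at t within J)"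
      "((\<lambda>t. snd (X t)) has_real_derivative (- q t * fst (X t) - k1 t * snd (X t)) / k0 t) (at t within J)"
      by (simp_all add: has_real_derivative_iff_has_vector_derivative)
  qed
  with that X(1) show thesis by simp
qed

section \<open>Linearity, vanishing of Wronskians and uniqueness\<close>

lemma SL_solution_lincomb:
  assumes "SL_solution J k0 k1 p q x" "SL_solution J k0 k1 p q u"
  shows "SL_solution J k0 k1 p q (\<lambda>t. c * x t + d * u t)"
  by (rule solves_SL_solution[OF solves_lincomb[OF assms[THEN SL_solution_solves]]])

lemma conf_deriv_lincomb:
  assumes "SL_solution J k0 k1 p q x" "SL_solution J k0 k1 p q u" "t \<in> J"
  shows "conf_deriv J k0 k1 (\<lambda>t. c * x t + d * u t) t =
    c * conf_deriv J k0 k1 x t + d * conf_deriv J k0 k1 u t"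
  using solves_conf_deriv[OF solves_lincomb[OF assms(1,2)[THEN SL_solution_solves]] assms(3), of c d]
    p_pos[OF assms(3)] by (simp add: add_divide_distrib)

text \<open>A derivative within \<open>J\<close> sees only values on \<open>J\<close>.\<close>

lemma conf_deriv_cong:
  assumes "SL_solution J k0 k1 p q x" "\<And>t. t \<in> J \<Longrightarrow> x t = u t" "t \<in> J"
  shows "conf_deriv J k0 k1 x t = conf_deriv J k0 k1 u t"
proof -
  have "x differentiable (at t within J)"
    using assms(1,3) by (simp add: SL_solution_def)
  note dx = has_real_derivative_conf_deriv[OF this assms(3)]
  note du = has_field_derivative_transform_within[OF dx zero_less_one assms(3) assms(2)]
  show ?thesis
    using conf_deriv_eq[OF dx assms(3)] conf_deriv_eq[OF du assms(3)] assms(2,3) by simp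
qed

lemma conf_wronskian_Abel:
  assumes "SL_solution J k0 k1 p q x" "SL_solution J k0 k1 p q u" "s \<in> J" "t \<in> J"
  shows "p t * conf_wronskian J k0 k1 x u t =
    p s * conf_wronskian J k0 k1 x u s * conf_exp0 k0 k1 t s ^ 2"
  using wronskian_Abel[OF assms(1,2)[THEN SL_solution_solves] assms(3,4)]
  by (simp add: conf_wronskian_def algebra_simps)

text \<open>In Abel's formula \<open>p\<close> and the exponential never vanish.\<close>

lemma conf_wronskian_eq_0_iff:
  assumes "SL_solution J k0 k1 p q x" "SL_solution J k0 k1 p q u" "s \<in> J" "t \<in> J"
  shows "conf_wronskian J k0 k1 x u t = 0 \<longleftrightarrow> conf_wronskian J k0 k1 x u s = 0"
proof -
  have "p t * conf_wronskian J k0 k1 x u t = 0 \<longleftrightarrow> p s * conf_wronskian J k0 k1 x u s = 0"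
    unfolding conf_wronskian_Abel[OF assms] by (simp add: conf_exp0_def)
  then show ?thesis using p_pos[OF assms(3)] p_pos[OF assms(4)] by simp
qed

text \<open>The difference \<open>z\<close> has zero data at \<open>s\<close>, so by Abel's formula
  its Wronskian with every solution vanishes on \<open>J\<close>. Taking \<open>\<phi>\<close> and
  \<open>\<psi>\<close> as those solutions and eliminating \<open>D z\<close> leaves
  \<open>z W(\<phi>, \<psi>) = 0\<close>.\<close>

lemma SL_solution_unique:
  assumes x: "SL_solution J k0 k1 p q x1" "SL_solution J k0 k1 p q x2"
    and basis: "SL_solution J k0 k1 p q \<phi>" "SL_solution J k0 k1 p q \<psi>"
      "conf_wronskian J k0 k1 \<phi> \<psi> s \<noteq> 0"
    and s: "s \<in> J" "x1 s = x2 s" "conf_deriv J k0 k1 x1 s = conf_deriv J k0 k1 x2 s"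
    and t: "t \<in> J"
  shows "x1 t = x2 t"
proof -
  \<comment> \<open>The coefficients are spelled out to fit the shape of
    \<open>SL_solution_lincomb\<close>.\<close>
  define z where "z t = 1 * x1 t + (-1) * x2 t" for t
  have z: "SL_solution J k0 k1 p q z"
    unfolding z_def by (rule SL_solution_lincomb[OF x])
  have zs: "z s = 0" "conf_deriv J k0 k1 z s = 0"
    using s conf_deriv_lincomb[OF x s(1), of 1 "-1"] by (simp_all add: z_def[abs_def])
  have "conf_wronskian J k0 k1 z u t = 0" if "SL_solution J k0 k1 p q u" for u
    using conf_wronskian_eq_0_iff[OF z that s(1) t] zs by (simp add: conf_wronskian_def)
  then have eqs: "z t * conf_deriv J k0 k1 \<phi> t = \<phi> t * conf_deriv J k0 k1 z t"
      "z t * conf_deriv J k0 k1 \<psi> t = \<psi> t * conf_deriv J k0 k1 z t"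
    using basis(1,2) by (simp_all add: conf_wronskian_def)
  have "z t * conf_wronskian J k0 k1 \<phi> \<psi> t =
      \<phi> t * (z t * conf_deriv J k0 k1 \<psi> t) - \<psi> t * (z t * conf_deriv J k0 k1 \<phi> t)"
    by (simp add: conf_wronskian_def algebra_simps)
  also have "\<dots> = 0" unfolding eqs by simp
  finally show ?thesis
    using conf_wronskian_eq_0_iff[OF basis(1,2) s(1) t] basis(3) by (simp add: z_def)
qed

section \<open>The boundary value problem and its Green's function\<close>

lemma SL_bvp_solution_unique:
  assumes triv: "\<forall>x. SL_bvp_solution J k0 k1 p q a b \<xi> \<beta> \<gamma> \<delta> 0 x \<longrightarrow> (\<forall>t\<in>J. x t = 0)"
    and u: "SL_bvp_solution J k0 k1 p q a b \<xi> \<beta> \<gamma> \<delta> \<eta> u"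
    and v: "SL_bvp_solution J k0 k1 p q a b \<xi> \<beta> \<gamma> \<delta> \<eta> v"
    and J: "a \<in> J" "b \<in> J" "t \<in> J"
  shows "v t = u t"
proof -
  have uv: "SL_solution J k0 k1 p q v" "SL_solution J k0 k1 p q u"
    using u v by (simp_all add: SL_bvp_solution_def)
  have "SL_bvp_solution J k0 k1 p q a b \<xi> \<beta> \<gamma> \<delta> 0 (\<lambda>t. 1 * v t + (-1) * u t)"
    using u v SL_solution_lincomb[OF uv, of 1 "-1"]
    unfolding SL_bvp_solution_def conf_deriv_lincomb[OF uv J(1)] conf_deriv_lincomb[OF uv J(2)]
    by (simp add: algebra_simps)
  from triv[rule_format, OF this J(3)] show ?thesis by simp
qed

lemma conf_wronskian_nonzero:
  assumes triv: "\<forall>x. SL_bvp_solution J k0 k1 p q a b \<xi> \<beta> \<gamma> \<delta> 0 x \<longrightarrow> (\<forall>t\<in>J. x t = 0)"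
    and J: "a \<in> J" "b \<in> J" "s \<in> J"
    and \<phi>: "SL_solution J k0 k1 p q \<phi>" "\<phi> a = \<beta>" "conf_deriv J k0 k1 \<phi> a = \<xi>"
    and \<psi>: "SL_solution J k0 k1 p q \<psi>" "\<psi> b = \<delta>" "conf_deriv J k0 k1 \<psi> b = - \<gamma>"
  shows "conf_wronskian J k0 k1 \<phi> \<psi> s \<noteq> 0"
proof
  assume "conf_wronskian J k0 k1 \<phi> \<psi> s = 0"
  \<comment> \<open>With the data of \<open>\<phi>\<close> at \<open>a\<close>, this equation is the
    left boundary condition for \<open>\<psi>\<close>; the right one holds by the data of
    \<open>\<psi>\<close> at \<open>b\<close>.\<close>
  then have "conf_wronskian J k0 k1 \<phi> \<psi> a = 0"
    using conf_wronskian_eq_0_iff[OF \<phi>(1) \<psi>(1) J(1,3)] by simp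
  then have "SL_bvp_solution J k0 k1 p q a b \<xi> \<beta> \<gamma> \<delta> 0 \<psi>"
    using \<phi> \<psi> by (simp add: SL_bvp_solution_def conf_wronskian_def algebra_simps)
  note \<psi>0 = triv[rule_format, OF this]
  have zero: "conf_deriv J k0 k1 x t = 0"
    if "SL_solution J k0 k1 p q x" "\<And>t. t \<in> J \<Longrightarrow> x t = 0" "t \<in> J" for x t
    using conf_deriv_cong[of x "\<lambda>_. 0" t] that conf_deriv_eq[of "\<lambda>_. 0" 0 t] by simp
  have "\<delta> = 0" "\<gamma> = 0"
    using \<psi>0[OF J(2)] zero[OF \<psi>(1) \<psi>0 J(2)] \<psi>(2,3) by simp_all
  \<comment> \<open>The right condition is now empty, and the data of \<open>\<phi>\<close> at
    \<open>a\<close> satisfy the left one.\<close>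
  with \<phi> have "SL_bvp_solution J k0 k1 p q a b \<xi> \<beta> \<gamma> \<delta> 0 \<phi>"
    by (simp add: SL_bvp_solution_def)
  note \<phi>0 = triv[rule_format, OF this]
  have "\<beta> = 0" "\<xi> = 0"
    using \<phi>0[OF J(1)] zero[OF \<phi>(1) \<phi>0 J(1)] \<phi>(2,3) by simp_all
  obtain x y where "solves x y" and xa: "x a = 1"
    using nontrivial_solution_exists[OF J(1)] .
  then have "SL_bvp_solution J k0 k1 p q a b \<xi> \<beta> \<gamma> \<delta> 0 x"
    using \<open>\<beta> = 0\<close> \<open>\<xi> = 0\<close> \<open>\<gamma> = 0\<close> \<open>\<delta> = 0\<close> by (simp add: SL_bvp_solution_def solves_SL_solution)
  from triv[rule_format, OF this J(1)] xa show False by simp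
qed

text \<open>Vanishing at \<open>s\<close> forces a multiple of
  \<open>\<phi>(s) \<psi> - \<psi>(s) \<phi>\<close>, whose conformable derivative at
  \<open>s\<close> is \<open>W(s)\<close>; division by \<open>p(s) W(s)\<close> normalises it to
  \<open>1 / p s\<close>.\<close>

lemma cauchy_function_basis:
  assumes sol: "SL_solution J k0 k1 p q \<phi>" "SL_solution J k0 k1 p q \<psi>"
    and W: "\<And>s. s \<in> J \<Longrightarrow> conf_wronskian J k0 k1 \<phi> \<psi> s \<noteq> 0"
  shows "cauchy_function J k0 k1 p q (\<lambda>t s.
    - (\<psi> s / (p s * conf_wronskian J k0 k1 \<phi> \<psi> s)) * \<phi> t +
    \<phi> s / (p s * conf_wronskian J k0 k1 \<phi> \<psi> s) * \<psi> t)"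
  unfolding cauchy_function_def
proof (intro ballI conjI)
  fix s assume s: "s \<in> J"
  let ?w = "conf_wronskian J k0 k1 \<phi> \<psi> s"
  let ?x = "\<lambda>t. - (\<psi> s / (p s * ?w)) * \<phi> t + \<phi> s / (p s * ?w) * \<psi> t"
  show "SL_solution J k0 k1 p q ?x"
    by (rule SL_solution_lincomb[OF sol])
  show "?x s = 0" by simp
  have "conf_deriv J k0 k1 ?x s = ?w / (p s * ?w)"
    unfolding conf_deriv_lincomb[OF sol s]
    by (simp add: conf_wronskian_def[of J k0 k1 \<phi> \<psi>] diff_divide_distrib)
  with W[OF s] show "conf_deriv J k0 k1 ?x s = 1 / p s" by simp
qed

text \<open>One direction exhibits \<open>x\<close> and \<open>u\<close>. In the other, the given
  Cauchy function is identified with \<open>x\<close> by uniqueness for initial values, so the right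
  end values \<open>\<eta>\<close> coincide, and the uniqueness clause for \<open>u'\<close> yields
  \<open>u\<close>.\<close>

lemma greens_function_iff:
  assumes triv: "\<forall>x. SL_bvp_solution J k0 k1 p q a b \<xi> \<beta> \<gamma> \<delta> 0 x \<longrightarrow> (\<forall>t\<in>J. x t = 0)"
    and J: "a \<in> J" "b \<in> J" "{a..b} \<subseteq> J"
    and \<phi>: "SL_solution J k0 k1 p q \<phi>" "\<phi> a = \<beta>" "conf_deriv J k0 k1 \<phi> a = \<xi>"
    and \<psi>: "SL_solution J k0 k1 p q \<psi>" "\<psi> b = \<delta>" "conf_deriv J k0 k1 \<psi> b = - \<gamma>"
  shows "greens_function J k0 k1 p q a b \<xi> \<beta> \<gamma> \<delta> G \<longleftrightarrow>
    (\<forall>t\<in>{a..b}. \<forall>s\<in>{a..b}. G t s = 1 / (p s * conf_wronskian J k0 k1 \<phi> \<psi> s) *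
       (if t \<le> s then \<phi> t * \<psi> s else \<psi> t * \<phi> s))"
proof -
  define w where "w s = p s * conf_wronskian J k0 k1 \<phi> \<psi> s" for s
  define x where "x t s = - (\<psi> s / w s) * \<phi> t + \<phi> s / w s * \<psi> t" for t s
  \<comment> \<open>As a multiple of \<open>\<phi>\<close>, \<open>u\<close> meets the left
    condition. The sum \<open>u + x\<close> is a multiple of \<open>\<psi>\<close> and so meets the
    homogeneous right condition, which is what \<open>\<eta>\<close> demands of \<open>u\<close>.
    The zero term again fits the linear combination lemmas.\<close>
  define u where "u t s = \<psi> s / w s * \<phi> t + 0 * \<psi> t" for t s
  define g where "g t s = 1 / w s * (if t \<le> s then \<phi> t * \<psi> s else \<psi> t * \<phi> s)" for t s
  define \<eta> where "\<eta> x' s = - \<gamma> * x' b s - \<delta> * conf_deriv J k0 k1 (\<lambda>t. x' t s) b"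
    for x' :: "real \<Rightarrow> real \<Rightarrow> real" and s
  note sol = \<phi>(1) \<psi>(1)
  have W: "conf_wronskian J k0 k1 \<phi> \<psi> s \<noteq> 0" if "s \<in> J" for s
    using conf_wronskian_nonzero[OF triv J(1,2) that \<phi> \<psi>] .
  have cauchy: "cauchy_function J k0 k1 p q x"
    unfolding x_def[abs_def] w_def by (rule cauchy_function_basis[OF sol W])
  have bvp: "SL_bvp_solution J k0 k1 p q a b \<xi> \<beta> \<gamma> \<delta> (\<eta> x s) (\<lambda>t. u t s)" for s
    unfolding SL_bvp_solution_def \<eta>_def u_def x_def conf_deriv_lincomb[OF sol J(1)]
      conf_deriv_lincomb[OF sol J(2)] \<phi> \<psi>
    by (intro conjI SL_solution_lincomb[OF sol]) (simp_all add: algebra_simps)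
  \<comment> \<open>Both cases apply on the diagonal, consistently because
    \<open>x s s = 0\<close>.\<close>
  have gx: "t \<le> s \<Longrightarrow> g t s = u t s" "s \<le> t \<Longrightarrow> g t s = u t s + x t s" for t s
    by (auto simp: g_def u_def x_def mult.commute)
  show ?thesis
    unfolding w_def[symmetric] g_def[symmetric]
  proof
    assume "\<forall>t\<in>{a..b}. \<forall>s\<in>{a..b}. G t s = g t s"
    then show "greens_function J k0 k1 p q a b \<xi> \<beta> \<gamma> \<delta> G"
      unfolding greens_function_def Let_def \<eta>_def[symmetric]
      by (intro exI[of _ x] exI[of _ u] conjI cauchy ballI bvp allI impI)
        (auto simp: gx intro: SL_bvp_solution_unique[OF triv bvp _ J(1,2)])
  next
    assume "greens_function J k0 k1 p q a b \<xi> \<beta> \<gamma> \<delta> G"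
    then obtain x' u' where c': "cauchy_function J k0 k1 p q x'"
      and u': "\<And>s v t. s \<in> {a..b} \<Longrightarrow> SL_bvp_solution J k0 k1 p q a b \<xi> \<beta> \<gamma> \<delta> (\<eta> x' s) v \<Longrightarrow>
        t \<in> J \<Longrightarrow> v t = u' t s"
      and G: "\<And>t s. t \<in> {a..b} \<Longrightarrow> s \<in> {a..b} \<Longrightarrow>
        (t \<le> s \<longrightarrow> G t s = u' t s) \<and> (s \<le> t \<longrightarrow> G t s = u' t s + x' t s)"
      unfolding greens_function_def Let_def \<eta>_def[symmetric] by blast
    show "\<forall>t\<in>{a..b}. \<forall>s\<in>{a..b}. G t s = g t s"
    proof (intro ballI)
      fix t s assume ts: "t \<in> {a..b}" "s \<in> {a..b}"
      with J(3) have "t \<in> J" "s \<in> J" by auto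
      have xs: "SL_solution J k0 k1 p q (\<lambda>t. x t s)" "x s s = 0"
        "conf_deriv J k0 k1 (\<lambda>t. x t s) s = 1 / p s"
        using cauchy \<open>s \<in> J\<close> by (simp_all add: cauchy_function_def)
      have xs': "SL_solution J k0 k1 p q (\<lambda>t. x' t s)" "x' s s = 0"
        "conf_deriv J k0 k1 (\<lambda>t. x' t s) s = 1 / p s"
        using c' \<open>s \<in> J\<close> by (simp_all add: cauchy_function_def)
      \<comment> \<open>Agreement is established on all of \<open>J\<close>, since the derivative at
        \<open>b\<close> is taken within \<open>J\<close>.\<close>
      have x_eq: "x r s = x' r s" if "r \<in> J" for r
        by (rule SL_solution_unique[OF xs(1) xs'(1) sol W[OF \<open>s \<in> J\<close>] \<open>s \<in> J\<close> _ _ that])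
          (simp_all only: xs xs')
      have "conf_deriv J k0 k1 (\<lambda>t. x t s) b = conf_deriv J k0 k1 (\<lambda>t. x' t s) b"
        by (rule conf_deriv_cong[OF xs(1) x_eq J(2)])
      then have "\<eta> x s = \<eta> x' s"
        by (simp add: \<eta>_def x_eq[OF J(2)])
      then have "u t s = u' t s"
        using u'[OF ts(2) _ \<open>t \<in> J\<close>, of "\<lambda>t. u t s"] bvp[of s] by simp
      with G[OF ts] x_eq[OF \<open>t \<in> J\<close>] show "G t s = g t s"
        by (cases t s rule: le_cases) (simp_all add: gx)
    qed
  qed
qed

text \<open>By Abel's formula and \<open>e\<^sub>0(s, t) = 1 / e\<^sub>0(t, s)\<close>, both sides
  equal \<open>1 / (p(s) W(s) e\<^sub>0(t, s))\<close>.\<close>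

lemma conf_exp0_over_conf_wronskian_symmetric:
  assumes sol: "SL_solution J k0 k1 p q \<phi>" "SL_solution J k0 k1 p q \<psi>" and "s \<in> J" "t \<in> J"
    and W: "conf_wronskian J k0 k1 \<phi> \<psi> s \<noteq> 0"
  shows "conf_exp0 k0 k1 s t / (p s * conf_wronskian J k0 k1 \<phi> \<psi> s) =
    conf_exp0 k0 k1 t s / (p t * conf_wronskian J k0 k1 \<phi> \<psi> t)"
proof -
  have "conf_exp0 k0 k1 t s \<noteq> 0" by (simp add: conf_exp0_def)
  with conf_exp0_reverse[of s t] have "conf_exp0 k0 k1 s t = 1 / conf_exp0 k0 k1 t s"
    by (simp add: field_simps)
  then show ?thesis
    unfolding conf_wronskian_Abel[OF sol assms(3,4)] by (simp add: power2_eq_square)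
qed

end

section \<open>Passage from the two-parameter controls to a fixed \<open>\<alpha>\<close>, and
  symmetry\<close>

theorem theorem11p5:
  fixes I J :: "real set"
    and \<kappa>0 \<kappa>1 :: "real \<Rightarrow> real \<Rightarrow> real"
    and p q \<phi> \<psi> :: "real \<Rightarrow> real"
    and \<alpha> a b \<xi> \<beta> \<gamma> \<delta> :: real
  assumes "is_interval I"
    and "proportional_controls I \<kappa>0 \<kappa>1"
    and "0 < \<alpha>" "\<alpha> \<le> 1"
    and "continuous_on I p" "continuous_on I q" "\<forall>t\<in>I. 0 < p t"
    and "a < b"
    and "is_interval J" "{a..b} \<subseteq> J" "J \<subseteq> I"
    and "\<forall>x. SL_bvp_solution J (\<kappa>0 \<alpha>) (\<kappa>1 \<alpha>) p q a b \<xi> \<beta> \<gamma> \<delta> 0 x \<longrightarrow> (\<forall>t\<in>J. x t = 0)"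
    and "SL_solution J (\<kappa>0 \<alpha>) (\<kappa>1 \<alpha>) p q \<phi>"
        "\<phi> a = \<beta>" "conf_deriv J (\<kappa>0 \<alpha>) (\<kappa>1 \<alpha>) \<phi> a = \<xi>"
    and "SL_solution J (\<kappa>0 \<alpha>) (\<kappa>1 \<alpha>) p q \<psi>"
        "\<psi> b = \<delta>" "conf_deriv J (\<kappa>0 \<alpha>) (\<kappa>1 \<alpha>) \<psi> b = - \<gamma>"
  shows "(\<forall>s\<in>{a..b}. conf_wronskian J (\<kappa>0 \<alpha>) (\<kappa>1 \<alpha>) \<phi> \<psi> s \<noteq> 0) \<and>
    (\<forall>G. greens_function J (\<kappa>0 \<alpha>) (\<kappa>1 \<alpha>) p q a b \<xi> \<beta> \<gamma> \<delta> G \<longleftrightarrow>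
       (\<forall>t\<in>{a..b}. \<forall>s\<in>{a..b}.
          G t s = 1 / (p s * conf_wronskian J (\<kappa>0 \<alpha>) (\<kappa>1 \<alpha>) \<phi> \<psi> s) *
                  (if t \<le> s then \<phi> t * \<psi> s else \<psi> t * \<phi> s))) \<and>
    (\<forall>G. greens_function J (\<kappa>0 \<alpha>) (\<kappa>1 \<alpha>) p q a b \<xi> \<beta> \<gamma> \<delta> G \<longrightarrow>
       (\<forall>t\<in>{a..b}. \<forall>s\<in>{a..b}.
          conf_exp0 (\<kappa>0 \<alpha>) (\<kappa>1 \<alpha>) s t * G t s = conf_exp0 (\<kappa>0 \<alpha>) (\<kappa>1 \<alpha>) t s * G s t))"
proof -
  let ?k0 = "\<kappa>0 \<alpha>" and ?k1 = "\<kappa>1 \<alpha>"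
  have J: "a \<in> J" "b \<in> J" using \<open>a < b\<close> \<open>{a..b} \<subseteq> J\<close> by auto
  \<comment> \<open>Joint continuity is restricted to the slice at the fixed
    \<open>\<alpha>\<close>.\<close>
  have restrict: "continuous_on J (\<lambda>t. f \<alpha> t)"
    if "continuous_on ({0..1} \<times> I) (\<lambda>(\<alpha>, t). f \<alpha> t)" for f :: "real \<Rightarrow> real \<Rightarrow> real"
  proof -
    have "continuous_on J ((\<lambda>(\<alpha>, t). f \<alpha> t) \<circ> Pair \<alpha>)"
      using \<open>J \<subseteq> I\<close> \<open>0 < \<alpha>\<close> \<open>\<alpha> \<le> 1\<close>
      by (intro continuous_on_compose continuous_on_subset[OF that] continuous_intros) auto
    then show ?thesis by (simp add: o_def)
  qed
  have k0_pos: "0 < ?k0 t" if "t \<in> J" for t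
  proof -
    have "t \<in> I" using that \<open>J \<subseteq> I\<close> by blast
    then have "0 \<le> ?k0 t" "?k0 t \<noteq> 0"
      using \<open>proportional_controls I \<kappa>0 \<kappa>1\<close> \<open>0 < \<alpha>\<close> \<open>\<alpha> \<le> 1\<close>
      by (auto simp: proportional_controls_def)
    then show ?thesis by simp
  qed
  interpret conformable_SL J ?k0 ?k1 p q
  proof
    show "continuous_on J ?k0" "continuous_on J ?k1"
      using restrict \<open>proportional_controls I \<kappa>0 \<kappa>1\<close> by (simp_all add: proportional_controls_def)
    show "continuous_on J p" "continuous_on J q"
      using \<open>J \<subseteq> I\<close> \<open>continuous_on I p\<close> \<open>continuous_on I q\<close> continuous_on_subset by blast+
    show "\<exists>a\<in>J. \<exists>b\<in>J. a < b" using J \<open>a < b\<close> by blast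
    show "0 < p t" if "t \<in> J" for t using that \<open>J \<subseteq> I\<close> \<open>\<forall>t\<in>I. 0 < p t\<close> by blast
  qed (fact \<open>is_interval J\<close> k0_pos)+
  note \<phi> = assms(13-15) and \<psi> = assms(16-18)
  have W: "conf_wronskian J ?k0 ?k1 \<phi> \<psi> s \<noteq> 0" if "s \<in> J" for s
    using conf_wronskian_nonzero[OF assms(12) J that \<phi> \<psi>] .
  note green = greens_function_iff[OF assms(12) J \<open>{a..b} \<subseteq> J\<close> \<phi> \<psi>]
  have "conf_exp0 ?k0 ?k1 s t * G t s = conf_exp0 ?k0 ?k1 t s * G s t"
    if "greens_function J ?k0 ?k1 p q a b \<xi> \<beta> \<gamma> \<delta> G" "t \<in> {a..b}" "s \<in> {a..b}" for G t s
  proof -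
    have "s \<in> J" "t \<in> J" using that \<open>{a..b} \<subseteq> J\<close> by auto
    \<comment> \<open>Swapping \<open>t\<close> and \<open>s\<close> exchanges the branches, so
      \<open>?g\<close> is symmetric and only the prefactors have to be compared.\<close>
    let ?g = "\<lambda>t s. if t \<le> s then \<phi> t * \<psi> s else \<psi> t * \<phi> s"
    have "conf_exp0 ?k0 ?k1 s t * G t s =
        conf_exp0 ?k0 ?k1 s t / (p s * conf_wronskian J ?k0 ?k1 \<phi> \<psi> s) * ?g t s"
      using green[THEN iffD1, OF that(1)] that(2,3) by simp
    also have "\<dots> = conf_exp0 ?k0 ?k1 t s / (p t * conf_wronskian J ?k0 ?k1 \<phi> \<psi> t) * ?g s t"
      unfolding conf_exp0_over_conf_wronskian_symmetric[OF \<phi>(1) \<psi>(1) \<open>s \<in> J\<close> \<open>t \<in> J\<close> W[OF \<open>s \<in> J\<close>]]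
      by auto
    also have "\<dots> = conf_exp0 ?k0 ?k1 t s * G s t"
      using green[THEN iffD1, OF that(1)] that(2,3) by simp
    finally show ?thesis .
  qed
  then show ?thesis
    using W \<open>{a..b} \<subseteq> J\<close> by (intro conjI allI ballI impI green) auto
qed

end
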